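(* Let $\Gamma$ be a connected finite simple graph on $N\ge3$ vertices with minimum degree $d=1$. If $\Gamma$ is not the path $P_4$ on $4$ vertices, then $\varepsilon<\frac12$.
   Context: For a finite simple graph $\Gamma=(V,E)$ without isolated vertices, $\deg v$ is the number of neighbours of $v$ and $\mathcal N(v)=\{w\in V: w\sim v\}$. The normalized Laplacian acts on functions $f:V\to\mathbb R$ by $\Delta f(v)=f(v)-\frac{1}{\deg v}\sum_{w\sim v}f(w)$; its eigenvalues are $0=\lambda_1\le\lambda_2\le\dots\le\lambda_N$, and $\varepsilon:=\min_i|1-\lambda_i|$. $d$ denotes the minimum vertex degree. *)

theory Defs
  imports Main "HOL-Analysis.Analysis"
begin

definition simple_graph :: "'a set \<Rightarrow> ('a \<Rightarrow> 'a \<Rightarrow> bool) \<Rightarrow> bool" where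
  "simple_graph V E \<longleftrightarrow> finite V \<and> (\<forall>v w. E v w \<longrightarrow> E w v)
     \<and> (\<forall>v. \<not> E v v) \<and> (\<forall>v w. E v w \<longrightarrow> v \<in> V \<and> w \<in> V)"

definition nbhd :: "'a set \<Rightarrow> ('a \<Rightarrow> 'a \<Rightarrow> bool) \<Rightarrow> 'a \<Rightarrow> 'a set" where
  "nbhd V E v = {w \<in> V. E v w}"

definition deg :: "'a set \<Rightarrow> ('a \<Rightarrow> 'a \<Rightarrow> bool) \<Rightarrow> 'a \<Rightarrow> nat" where
  "deg V E v = card (nbhd V E v)"

definition min_degree :: "'a set \<Rightarrow> ('a \<Rightarrow> 'a \<Rightarrow> bool) \<Rightarrow> nat" where
  "min_degree V E = Min (deg V E ` V)"

definition connected_graph :: "'a set \<Rightarrow> ('a \<Rightarrow> 'a \<Rightarrow> bool) \<Rightarrow> bool" where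
  "connected_graph V E \<longleftrightarrow> V \<noteq> {} \<and> (\<forall>v\<in>V. \<forall>w\<in>V. E\<^sup>*\<^sup>* v w)"

definition is_P4 :: "'a set \<Rightarrow> ('a \<Rightarrow> 'a \<Rightarrow> bool) \<Rightarrow> bool" where
  "is_P4 V E \<longleftrightarrow> (\<exists>a b c d. distinct [a, b, c, d] \<and> V = {a, b, c, d} \<and>
     (\<forall>x y. E x y \<longleftrightarrow> {x, y} \<in> {{a, b}, {b, c}, {c, d}}))"

definition norm_laplacian :: "'a set \<Rightarrow> ('a \<Rightarrow> 'a \<Rightarrow> bool) \<Rightarrow> ('a \<Rightarrow> real) \<Rightarrow> 'a \<Rightarrow> real" where
  "norm_laplacian V E f v = f v - (\<Sum>w\<in>nbhd V E v. f w) / real (deg V E v)"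

definition is_eigenvalue :: "'a set \<Rightarrow> ('a \<Rightarrow> 'a \<Rightarrow> bool) \<Rightarrow> real \<Rightarrow> bool" where
  "is_eigenvalue V E lam \<longleftrightarrow> (\<exists>f. (\<exists>v\<in>V. f v \<noteq> 0) \<and>
     (\<forall>v\<in>V. norm_laplacian V E f v = lam * f v))"

definition spectral_gap_eps :: "'a set \<Rightarrow> ('a \<Rightarrow> 'a \<Rightarrow> bool) \<Rightarrow> real" where
  "spectral_gap_eps V E = Min {\<bar>1 - lam\<bar> | lam. is_eigenvalue V E lam}"

end

(* If all eigenvalues of the walk operator M = 1 - Delta have modulus at least 1/2, then
   |M f|^2 >= |f|^2 / 4 for every f, in the inner product weighted by the degrees. Let v be a
   leaf and u its neighbour. Functions supported on two neighbours of a common vertex show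
   that deg u is 2 or 3 and that a neighbour w of u other than v has no leaf attached, except
   on P4. The inequality is then violated by the function that is 1 at w and, next to those
   neighbours of w whose degree is at most 3, takes the value -1 at the leaves and -1/2 at the
   other vertices of degree 2. *)

theory Submission
  imports Defs
begin

section \<open>The spectrum of the walk operator\<close>

locale positive_degree_graph =
  fixes V :: "'a set" and E :: "'a \<Rightarrow> 'a \<Rightarrow> bool"
  assumes simple: "simple_graph V E"
    and deg_pos: "v \<in> V \<Longrightarrow> deg V E v > 0"
begin

abbreviation N :: "'a \<Rightarrow> 'a set" where "N \<equiv> nbhd V E"

abbreviation d :: "'a \<Rightarrow> real" where "d v \<equiv> real (deg V E v)"

definition nbr_sum :: "('a \<Rightarrow> real) \<Rightarrow> 'a \<Rightarrow> real" where
  "nbr_sum f v = (\<Sum>w\<in>N v. f w)"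

text \<open>The degree weights cancel the denominators of \<open>walk\<close>, which is what makes
  it self-adjoint even when the graph is not regular.\<close>

definition inner_deg :: "('a \<Rightarrow> real) \<Rightarrow> ('a \<Rightarrow> real) \<Rightarrow> real" where
  "inner_deg f g = (\<Sum>v\<in>V. d v * f v * g v)"

definition walk :: "('a \<Rightarrow> real) \<Rightarrow> 'a \<Rightarrow> real" where
  "walk f v = nbr_sum f v / d v"

section \<open>Neighbourhoods and double counting over edges\<close>

lemma finite_V [simp]: "finite V"
  using simple by (simp add: simple_graph_def)

lemma N_iff: "w \<in> N v \<longleftrightarrow> E v w"
  using simple by (auto simp: simple_graph_def nbhd_def)

lemma N_sym: "w \<in> N v \<longleftrightarrow> v \<in> N w"
  using simple by (auto simp: N_iff simple_graph_def)

lemma N_irrefl [simp]: "v \<notin> N v"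
  using simple by (auto simp: N_iff simple_graph_def)

lemma N_subset: "N v \<subseteq> V"
  by (auto simp: nbhd_def)

lemma N_in_V: "w \<in> N v \<Longrightarrow> w \<in> V" "w \<in> N v \<Longrightarrow> v \<in> V"
  using simple by (auto simp: N_iff simple_graph_def)

lemma finite_N [simp]: "finite (N v)"
  using N_subset finite_V finite_subset by blast

lemma d_pos: "v \<in> V \<Longrightarrow> d v > 0"
  using deg_pos by simp

lemma deg_card: "deg V E v = card (N v)"
  by (simp add: deg_def)

lemma sum_N_if: "(\<Sum>x\<in>V. if w \<in> N x then f x else 0) = (\<Sum>x\<in>N w. f x)"
proof -
  have "N w = {x \<in> V. w \<in> N x}"
    using N_sym N_in_V by blast
  then show ?thesis
    by (simp add: sum.inter_filter)
qed

lemma sum_nbr_swap: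
  "(\<Sum>v\<in>V. \<Sum>w\<in>N v. f v w) = (\<Sum>w\<in>V. \<Sum>v\<in>N w. f v w)"
proof -
  have "(\<Sum>v\<in>V. \<Sum>w\<in>N v. f v w) = (\<Sum>v\<in>V. \<Sum>w | w \<in> V \<and> E v w. f v w)"
    by (simp add: nbhd_def)
  also have "\<dots> = (\<Sum>w\<in>V. \<Sum>v | v \<in> V \<and> E v w. f v w)"
    by (rule sum.swap_restrict) auto
  also have "\<dots> = (\<Sum>w\<in>V. \<Sum>v\<in>N w. f v w)"
    using simple by (intro sum.cong) (auto simp: nbhd_def simple_graph_def)
  finally show ?thesis .
qed

section \<open>The walk operator as a self-adjoint operator\<close>

lemma d_walk: "v \<in> V \<Longrightarrow> d v * walk f v = nbr_sum f v"
  using d_pos[of v] by (simp add: walk_def)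

lemma inner_walk_left: "inner_deg (walk f) g = (\<Sum>v\<in>V. \<Sum>w\<in>N v. f w * g v)"
  unfolding inner_deg_def
  by (intro sum.cong refl) (simp add: d_walk nbr_sum_def sum_distrib_right)

lemma inner_commute: "inner_deg f g = inner_deg g f"
  by (simp add: inner_deg_def mult_ac)

text \<open>Both sides are sums over oriented edges, and reversing the edges exchanges them.\<close>

lemma walk_selfadjoint: "inner_deg (walk f) g = inner_deg f (walk g)"
  unfolding inner_commute[of f] inner_walk_left
  by (subst sum_nbr_swap) (simp add: mult_ac)

text \<open>Scaling is later obtained from the case where one summand has coefficient 0; hence the
  terms \<open>0 * f v\<close> further on.\<close>

lemma inner_add_left: "inner_deg (\<lambda>v. a * f v + b * g v) h = a * inner_deg f h + b * inner_deg g h"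
  by (simp add: inner_deg_def algebra_simps sum.distrib sum_distrib_left)

lemma inner_add_right: "inner_deg h (\<lambda>v. a * f v + b * g v) = a * inner_deg h f + b * inner_deg h g"
  by (simp add: inner_deg_def algebra_simps sum.distrib sum_distrib_left)

lemma inner_nonneg: "inner_deg f f \<ge> 0"
  unfolding inner_deg_def by (intro sum_nonneg) (simp add: mult.assoc)

lemma inner_eq_0_iff: "inner_deg f f = 0 \<longleftrightarrow> (\<forall>v\<in>V. f v = 0)"
proof -
  have "inner_deg f f = 0 \<longleftrightarrow> (\<forall>v\<in>V. d v * f v * f v = 0)"
    unfolding inner_deg_def by (intro sum_nonneg_eq_0_iff) (simp_all add: mult.assoc)
  then show ?thesis
    using deg_pos by fastforce
qed

lemma inner_cong: "(\<And>v. v \<in> V \<Longrightarrow> f v = f' v) \<Longrightarrow> (\<And>v. v \<in> V \<Longrightarrow> g v = g' v)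
    \<Longrightarrow> inner_deg f g = inner_deg f' g'"
  by (simp add: inner_deg_def)

lemma walk_cong: "(\<And>v. v \<in> V \<Longrightarrow> f v = g v) \<Longrightarrow> walk f v = walk g v"
  unfolding walk_def nbr_sum_def by (metis (no_types, lifting) N_in_V(1) sum.cong)

lemma walk_add: "walk (\<lambda>v. a * f v + b * g v) v = a * walk f v + b * walk g v"
  by (simp add: walk_def nbr_sum_def sum.distrib sum_distrib_left add_divide_distrib)

lemma inner_walk_walk: "inner_deg (walk f) (walk f) = (\<Sum>x\<in>V. (nbr_sum f x)\<^sup>2 / d x)"
  unfolding inner_deg_def
  by (intro sum.cong refl) (simp add: walk_def power2_eq_square)

section \<open>Orthogonality of eigenfunctions and finiteness of the spectrum\<close>

lemma is_eigenvalue_iff: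
  "is_eigenvalue V E lam \<longleftrightarrow>
    (\<exists>f. (\<exists>v\<in>V. f v \<noteq> 0) \<and> (\<forall>v\<in>V. walk f v = (1 - lam) * f v))"
  unfolding is_eigenvalue_def norm_laplacian_def walk_def nbr_sum_def
  by (intro ex_cong1 conj_cong refl ball_cong) (auto simp: algebra_simps)

lemma eigen_orthogonal:
  assumes "\<forall>v\<in>V. walk f v = a * f v" "\<forall>v\<in>V. walk g v = b * g v" "a \<noteq> b"
  shows "inner_deg f g = 0"
proof -
  have "a * inner_deg f g = inner_deg (walk f) g"
    using inner_add_left[of a f 0 f g] assms(1) inner_cong[of "walk f" "\<lambda>v. a * f v + 0 * f v" g g]
    by simp
  also have "\<dots> = inner_deg f (walk g)"
    by (rule walk_selfadjoint)
  also have "\<dots> = b * inner_deg f g"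
    using inner_add_right[of f b g 0 g] assms(2) inner_cong[of f f "walk g" "\<lambda>v. b * g v + 0 * g v"]
    by simp
  finally show ?thesis
    using assms(3) by simp
qed

lemma inner_indicator: "v \<in> V \<Longrightarrow> inner_deg (\<lambda>x. if x = v then 1 else 0) f = d v * f v"
proof -
  assume "v \<in> V"
  have "inner_deg (\<lambda>x. if x = v then 1 else 0) f = (\<Sum>x\<in>V. if x = v then d x * f x else 0)"
    unfolding inner_deg_def by (intro sum.cong) auto
  then show ?thesis
    using \<open>v \<in> V\<close> by simp
qed

text \<open>Bessel's inequality for the indicator functions, added up over all vertices.\<close>

lemma orthonormal_card_le:
  assumes fin: "finite F"
    and norm: "\<And>a. a \<in> F \<Longrightarrow> inner_deg (e a) (e a) = 1"
    and orth: "\<And>a b. a \<in> F \<Longrightarrow> b \<in> F \<Longrightarrow> a \<noteq> b \<Longrightarrow> inner_deg (e a) (e b) = 0"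
  shows "card F \<le> card V"
proof -
  have bessel: "(\<Sum>a\<in>F. d v * (e a v)\<^sup>2) \<le> 1" if v: "v \<in> V" for v
  proof -
    define i where "i = (\<lambda>x. if x = v then 1 else 0 :: real)"
    \<comment> \<open>\<open>g\<close> is the orthogonal projection of the indicator
      \<open>i\<close> of \<open>v\<close> to the span of the \<open>e a\<close>, since the
      coefficient of \<open>e a\<close> is its inner product with \<open>i\<close>. Bessel's
      inequality is the nonnegativity of the squared norm of \<open>i - g\<close>.\<close>
    define g where "g = (\<lambda>x. \<Sum>a\<in>F. d v * e a v * e a x)"
    have sum_right: "inner_deg h g = (\<Sum>a\<in>F. d v * e a v * inner_deg h (e a))" for h
      unfolding inner_deg_def g_def sum_distrib_left
      by (subst sum.swap) (simp add: mult_ac)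
    have ge: "inner_deg g (e b) = d v * e b v" if "b \<in> F" for b
    proof -
      have "inner_deg g (e b) = (\<Sum>a\<in>F. d v * e a v * inner_deg (e b) (e a))"
        unfolding inner_commute[of g] by (rule sum_right)
      also have "\<dots> = (\<Sum>a\<in>F. if a = b then d v * e a v else 0)"
        using norm orth that by (intro sum.cong) auto
      finally show ?thesis
        using fin that by simp
    qed
    have gg: "inner_deg g g = (\<Sum>a\<in>F. (d v * e a v)\<^sup>2)"
      unfolding sum_right by (intro sum.cong refl) (simp add: ge power2_eq_square)
    have ig: "inner_deg i g = (\<Sum>a\<in>F. (d v * e a v)\<^sup>2)"
      unfolding sum_right i_def by (intro sum.cong refl) (simp add: inner_indicator v power2_eq_square)
    have ii: "inner_deg i i = d v"
      using inner_indicator[OF v, of i] by (simp add: i_def)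
    have "0 \<le> inner_deg (\<lambda>x. 1 * i x + (-1) * g x) (\<lambda>x. 1 * i x + (-1) * g x)"
      by (rule inner_nonneg)
    also have "\<dots> = d v - (\<Sum>a\<in>F. (d v * e a v)\<^sup>2)"
      unfolding inner_add_left inner_add_right inner_commute[of g i] ii ig gg by simp
    also have "\<dots> = d v * (1 - (\<Sum>a\<in>F. d v * (e a v)\<^sup>2))"
      by (simp add: algebra_simps sum_distrib_left power2_eq_square)
    finally show ?thesis
      using d_pos[OF v] by (simp add: zero_le_mult_iff)
  qed
  have "real (card F) = (\<Sum>a\<in>F. inner_deg (e a) (e a))"
    using norm by simp
  also have "\<dots> = (\<Sum>v\<in>V. \<Sum>a\<in>F. d v * (e a v)\<^sup>2)"
    unfolding inner_deg_def by (subst sum.swap) (simp add: power2_eq_square mult_ac)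
  also have "\<dots> \<le> (\<Sum>v\<in>V. 1)"
    by (intro sum_mono bessel)
  finally show ?thesis
    by simp
qed

text \<open>Normalised eigenfunctions of \<open>card V + 1\<close> distinct eigenvalues would be an
  orthonormal family that is too large. Finiteness is what gives the \<open>Min\<close> in
  \<open>spectral_gap_eps\<close> its meaning.\<close>

lemma finite_eigenvalues: "finite {lam. is_eigenvalue V E lam}"
proof (rule ccontr)
  assume "infinite {lam. is_eigenvalue V E lam}"
  then obtain F where F: "F \<subseteq> {lam. is_eigenvalue V E lam}" "card F = Suc (card V)" "finite F"
    using infinite_arbitrarily_large by blast
  then have "\<forall>a\<in>F. \<exists>f. (\<exists>v\<in>V. f v \<noteq> 0) \<and> (\<forall>v\<in>V. walk f v = (1 - a) * f v)"
    by (auto simp: is_eigenvalue_iff)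
  then obtain g where g: "\<And>a. a \<in> F \<Longrightarrow> \<exists>v\<in>V. g a v \<noteq> 0"
    "\<And>a. a \<in> F \<Longrightarrow> \<forall>v\<in>V. walk (g a) v = (1 - a) * g a v"
    by metis
  define e where "e = (\<lambda>a v. (1 / sqrt (inner_deg (g a) (g a))) * g a v + 0 * g a v)"
  have "card F \<le> card V"
  proof (rule orthonormal_card_le[of F e])
    show "inner_deg (e a) (e a) = 1" if "a \<in> F" for a
    proof -
      have "inner_deg (g a) (g a) > 0"
        using g(1)[OF that] inner_nonneg[of "g a"] inner_eq_0_iff[of "g a"] by force
      then show ?thesis
        unfolding e_def inner_add_left inner_add_right by (simp flip: power2_eq_square)
    qed
    show "inner_deg (e a) (e b) = 0" if "a \<in> F" "b \<in> F" "a \<noteq> b" for a b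
      unfolding e_def inner_add_left inner_add_right
      using eigen_orthogonal[OF g(2) g(2), of a b] that by simp
  qed (use F in auto)
  then show False
    using F by simp
qed

section \<open>Minimising the norm of the walk operator on the unit sphere\<close>

lemma walk_norm_minimiser:
  assumes "V \<noteq> {}"
  obtains g where "inner_deg g g = 1"
    "\<And>f. inner_deg (walk f) (walk f) \<ge> inner_deg (walk g) (walk g) * inner_deg f f"
proof -
  \<comment> \<open>Functions are defined on the whole type, so the coordinates outside
    \<open>V\<close> are pinned to 0; the box is then compact by Tychonoff's theorem. The interval
    from -1 to 1 suffices on \<open>V\<close> because all degrees there are at least 1.\<close>
  define B where "B = (\<lambda>i. if i \<in> V then {-1..1} else {0::real})"
  define S where "S = {f \<in> PiE UNIV B. inner_deg f f = 1}"
  have "compactin (product_topology (\<lambda>i. euclidean) UNIV) (PiE UNIV B)"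
    unfolding compactin_PiE by (auto simp: B_def)
  then have compB: "compact (PiE UNIV B)"
    by (simp add: euclidean_product_topology)
  have coord: "continuous_on UNIV (\<lambda>f :: 'a \<Rightarrow> real. f v)" for v
    by (rule continuous_on_product_coordinates)
  have cont: "continuous_on UNIV (\<lambda>f. inner_deg f f)"
    unfolding inner_deg_def by (intro continuous_intros coord)
  have cont_walk: "continuous_on UNIV (\<lambda>f. inner_deg (walk f) (walk f))"
    unfolding inner_deg_def walk_def nbr_sum_def divide_inverse
    by (intro continuous_intros coord)
  have "S = PiE UNIV B \<inter> (\<lambda>f. inner_deg f f) -` {1}"
    by (auto simp: S_def)
  moreover have "closed ((\<lambda>f. inner_deg f f) -` {1})"
    using cont by (intro closed_vimage) auto
  ultimately have "compact S"
    using compB by (simp add: compact_Int_closed)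
  \<comment> \<open>By homogeneity it is enough to compare with normalised functions. Truncation to
    0 outside \<open>V\<close> puts them in the box and changes no inner product.\<close>
  define nf where "nf = (\<lambda>f v. (if v \<in> V then (1 / sqrt (inner_deg f f)) * f v else 0 :: real))"
  have nf_inner: "inner_deg (nf f) (nf f) = 1" and nf_walk:
    "inner_deg (walk (nf f)) (walk (nf f)) = inner_deg (walk f) (walk f) / inner_deg f f"
    if f: "inner_deg f f > 0" for f
  proof -
    define c where "c = 1 / sqrt (inner_deg f f)"
    have c: "c * c = 1 / inner_deg f f"
      using f by (simp add: c_def power_divide flip: power2_eq_square)
    have eq: "nf f v = c * f v + 0 * f v" if "v \<in> V" for v
      using that by (simp add: nf_def c_def)
    have "inner_deg (nf f) (nf f) = inner_deg (\<lambda>v. c * f v + 0 * f v) (\<lambda>v. c * f v + 0 * f v)"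
      by (intro inner_cong eq)
    then show "inner_deg (nf f) (nf f) = 1"
      unfolding inner_add_left inner_add_right using c f by (simp flip: mult.assoc)
    have "inner_deg (walk (nf f)) (walk (nf f)) =
        inner_deg (\<lambda>v. c * walk f v + 0 * walk f v) (\<lambda>v. c * walk f v + 0 * walk f v)"
      unfolding walk_add[symmetric] by (intro inner_cong walk_cong eq)
    then show "inner_deg (walk (nf f)) (walk (nf f)) = inner_deg (walk f) (walk f) / inner_deg f f"
      unfolding inner_add_left inner_add_right using c by (simp flip: mult.assoc)
  qed
  have nf_S: "nf f \<in> S" if f: "inner_deg f f > 0" for f
  proof -
    have "nf f v \<in> B v" for v
    proof (cases "v \<in> V")
      case True
      have "d v * nf f v * nf f v \<le> inner_deg (nf f) (nf f)"
        unfolding inner_deg_def using True by (intro member_le_sum) (auto simp: mult.assoc)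
      then have "d v * (nf f v)\<^sup>2 \<le> 1"
        by (simp add: nf_inner[OF f] power2_eq_square mult.assoc)
      moreover have "1 \<le> d v"
        using deg_pos[OF True] by linarith
      ultimately have "(nf f v)\<^sup>2 \<le> 1"
        by (meson dual_order.trans mult_le_cancel_right1 not_less zero_le_power2)
      then have "\<bar>nf f v\<bar> \<le> 1"
        by (simp add: abs_square_le_1)
      then show ?thesis
        using True by (auto simp: B_def)
    qed (simp add: B_def nf_def)
    then show ?thesis
      using nf_inner[OF f] by (simp add: S_def PiE_iff)
  qed
  have "inner_deg (\<lambda>_. 1) (\<lambda>_. 1) > 0"
    using inner_nonneg[of "\<lambda>_. 1"] inner_eq_0_iff[of "\<lambda>_. 1"] assms by fastforce
  then have "S \<noteq> {}"
    using nf_S by blast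
  then obtain g where g: "g \<in> S" "\<forall>f\<in>S. inner_deg (walk g) (walk g) \<le> inner_deg (walk f) (walk f)"
    using continuous_attains_inf[OF \<open>compact S\<close> _ continuous_on_subset[OF cont_walk]] by auto
  show thesis
  proof
    show "inner_deg g g = 1"
      using g by (simp add: S_def)
    fix f
    show "inner_deg (walk f) (walk f) \<ge> inner_deg (walk g) (walk g) * inner_deg f f"
    proof (cases "inner_deg f f > 0")
      case True
      have "inner_deg (walk g) (walk g) \<le> inner_deg (walk (nf f)) (walk (nf f))"
        using g(2) nf_S[OF True] by blast
      then show ?thesis
        unfolding nf_walk[OF True] using True by (simp add: pos_le_divide_eq)
    next
      case False
      then have "inner_deg f f = 0"
        using inner_nonneg[of f] by simp
      then show ?thesis
        using inner_nonneg by simp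
    qed
  qed
qed

text \<open>A minimiser \<open>g\<close> of the norm of \<open>walk g\<close> satisfies \<open>walk (walk g) = s\<^sup>2 g\<close>, and
  then either \<open>g\<close> or \<open>walk g + s g\<close> is an eigenfunction of the walk operator.\<close>

lemma eigenvalue_lower_bound:
  assumes "V \<noteq> {}"
  obtains lam where "is_eigenvalue V E lam"
    "\<And>f. inner_deg (walk f) (walk f) \<ge> (1 - lam)\<^sup>2 * inner_deg f f"
proof -
  obtain g where g: "inner_deg g g = 1"
    and min: "\<And>f. inner_deg (walk f) (walk f) \<ge> inner_deg (walk g) (walk g) * inner_deg f f"
    using walk_norm_minimiser[OF assms] by blast
  define m where "m = inner_deg (walk g) (walk g)"
  define s where "s = sqrt m"
  have s2: "s\<^sup>2 = m"
    using inner_nonneg[of "walk g"] by (simp add: s_def m_def)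
  define r where "r = (\<lambda>v. 1 * walk (walk g) v + (- m) * g v)"
  have crit: "inner_deg r f = 0" for f
  proof -
    define P where "P = inner_deg (walk f) (walk f) - m * inner_deg f f"
    have P: "P \<ge> 0"
      using min[of f] by (simp add: P_def m_def)
    \<comment> \<open>First variation: the form |walk h|^2 - m |h|^2 is nonnegative and vanishes at
      \<open>g\<close>, so along \<open>g + t f\<close> only the linear and the quadratic term in
      \<open>t\<close> remain.\<close>
    have quad: "2 * t * inner_deg r f + t\<^sup>2 * P \<ge> 0" for t
    proof -
      let ?h = "\<lambda>v. 1 * g v + t * f v"
      have "inner_deg (walk ?h) (walk ?h) - m * inner_deg ?h ?h \<ge> 0"
        using min[of ?h] by (simp add: m_def)
      moreover have "walk ?h = (\<lambda>v. 1 * walk g v + t * walk f v)"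
        using walk_add[of 1 g t f] by (intro ext)
      then have "inner_deg (walk ?h) (walk ?h) =
          m + 2 * t * inner_deg (walk g) (walk f) + t\<^sup>2 * inner_deg (walk f) (walk f)"
        using inner_commute[of "walk f" "walk g"]
        by (simp only: inner_add_left inner_add_right m_def) (simp add: algebra_simps power2_eq_square)
      moreover have "inner_deg ?h ?h = 1 + 2 * t * inner_deg g f + t\<^sup>2 * inner_deg f f"
        using inner_commute[of f g] g
        by (simp only: inner_add_left inner_add_right) (simp add: algebra_simps power2_eq_square)
      moreover have "inner_deg (walk g) (walk f) = inner_deg r f + m * inner_deg g f"
        unfolding r_def inner_add_left using walk_selfadjoint[of "walk g" f] by simp
      ultimately show ?thesis
        unfolding P_def by (simp add: algebra_simps)
    qed
    \<comment> \<open>At \<open>t = - k\<close> the quadratic equals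
      \<open>- k\<^sup>2 * (P + 2)\<close>, which forces \<open>k = 0\<close>. Dividing by
      \<open>P + 1\<close> rather than \<open>P\<close> covers the case
      \<open>P = 0\<close>.\<close>
    define k where "k = inner_deg r f / (P + 1)"
    have k: "inner_deg r f = k * (P + 1)"
      using P by (simp add: k_def)
    have "k\<^sup>2 * (P + 2) \<le> 0"
      using quad[of "- k"] unfolding k by (simp add: algebra_simps power2_eq_square)
    then have "k = 0"
      using P by (simp add: mult_le_0_iff)
    then show ?thesis
      using k by simp
  qed
  have ww: "walk (walk g) v = m * g v" if "v \<in> V" for v
    using crit[of r] that by (auto simp: inner_eq_0_iff r_def)
  note witness = that
  have eig: thesis if "\<exists>v\<in>V. h v \<noteq> 0" "\<forall>v\<in>V. walk h v = c * h v" "c\<^sup>2 = m" for h c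
  proof (rule witness)
    show "is_eigenvalue V E (1 - c)"
      unfolding is_eigenvalue_iff using that by auto
  qed (use min \<open>c\<^sup>2 = m\<close> m_def in auto)
  \<comment> \<open>Factor \<open>walk\<^sup>2 - s\<^sup>2\<close>: since \<open>walk + s\<close>
    maps \<open>g\<close> to \<open>h\<close>, the operator \<open>walk - s\<close> annihilates
    \<open>h\<close> on \<open>V\<close>.\<close>
  define h where "h = (\<lambda>v. 1 * walk g v + s * g v)"
  have gne: "\<exists>v\<in>V. g v \<noteq> 0"
    using g inner_eq_0_iff[of g] by auto
  have wh: "walk h v = s * h v" if "v \<in> V" for v
    using ww[OF that] s2 unfolding h_def walk_add by (simp add: algebra_simps power2_eq_square)
  show thesis
  proof (cases "\<exists>v\<in>V. h v \<noteq> 0")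
    case True
    then show thesis
      using eig[of h s] wh s2 by blast
  next
    case False
    then have "\<forall>v\<in>V. walk g v = (- s) * g v"
      by (auto simp: h_def)
    then show thesis
      using eig[of g "- s"] gne s2 by simp
  qed
qed

text \<open>The minimising eigenvalue has |1 - lam| at least \<open>spectral_gap_eps\<close>. The
  right-hand side is the squared norm of \<open>walk f\<close>, written out for use with test
  functions.\<close>

lemma spectral_gap_bound:
  assumes "V \<noteq> {}"
  shows "(spectral_gap_eps V E)\<^sup>2 * (\<Sum>x\<in>V. d x * (f x)\<^sup>2) \<le> (\<Sum>x\<in>V. (nbr_sum f x)\<^sup>2 / d x)"
proof -
  let ?S = "{\<bar>1 - lam\<bar> | lam. is_eigenvalue V E lam}"
  obtain lam where lam: "is_eigenvalue V E lam"
    "\<And>f. inner_deg (walk f) (walk f) \<ge> (1 - lam)\<^sup>2 * inner_deg f f"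
    using eigenvalue_lower_bound[OF assms] by blast
  have fin: "finite ?S"
    using finite_eigenvalues by simp
  have "spectral_gap_eps V E \<in> ?S"
    unfolding spectral_gap_eps_def using fin lam(1) by (intro Min_in) auto
  then have nn: "spectral_gap_eps V E \<ge> 0"
    by auto
  have "spectral_gap_eps V E \<le> \<bar>1 - lam\<bar>"
    unfolding spectral_gap_eps_def using fin lam(1) by (intro Min_le) auto
  then have "(spectral_gap_eps V E)\<^sup>2 \<le> (1 - lam)\<^sup>2"
    using nn by (metis power2_abs power_mono)
  then have "(spectral_gap_eps V E)\<^sup>2 * inner_deg f f \<le> inner_deg (walk f) (walk f)"
    using lam(2)[of f] mult_right_mono[OF _ inner_nonneg[of f]] by fastforce
  then show "(spectral_gap_eps V E)\<^sup>2 * (\<Sum>x\<in>V. d x * (f x)\<^sup>2) \<le> (\<Sum>x\<in>V. (nbr_sum f x)\<^sup>2 / d x)"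
    unfolding inner_walk_walk by (simp add: inner_deg_def power2_eq_square mult.assoc)
qed

end

section \<open>Graphs with spectral gap at least 1/2\<close>

text \<open>The negated conclusion as a statement about test functions: the factor 4 is the inverse
  square of the bound 1/2.\<close>

locale half_gap_graph = positive_degree_graph +
  assumes gap: "(\<Sum>x\<in>V. d x * (f x)\<^sup>2) \<le> 4 * (\<Sum>x\<in>V. (nbr_sum f x)\<^sup>2 / d x)"
begin

text \<open>The value of |walk f|^2 - |f|^2 / 4 at the indicator function of
  \<open>w\<close>.\<close>

definition excess :: "'a \<Rightarrow> real" where
  "excess w = (\<Sum>z\<in>N w. 1 / d z) - d w / 4"

text \<open>Test with \<open>x\<close> at \<open>w\<close> and \<open>- y\<close> at
  \<open>w'\<close>. Because of the opposite signs every common neighbour contributes a nonpositive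
  cross term; the one at \<open>u\<close> is kept and the others are dropped.\<close>

lemma excess_pair_form:
  assumes w: "w \<in> N u" "w' \<in> N u" "w \<noteq> w'" and xy: "x \<ge> 0" "y \<ge> 0"
  shows "x\<^sup>2 * excess w + y\<^sup>2 * excess w' \<ge> 2 * x * y / d u"
proof -
  define f where "f = (\<lambda>z. if z = w then x else if z = w' then - y else 0)"
  have V: "u \<in> V" "w \<in> V" "w' \<in> V"
    using w N_in_V by auto
  have f_add: "f z = (if z = w then x else 0) + (if z = w' then - y else 0)" for z
    using w(3) by (simp add: f_def)
  have nbr: "nbr_sum f v = (if w \<in> N v then x else 0) + (if w' \<in> N v then - y else 0)" for v
    unfolding nbr_sum_def f_add by (simp add: sum.distrib)
  have "(nbr_sum f v)\<^sup>2 / d v \<le> (if w \<in> N v then x\<^sup>2 * (1 / d v) else 0)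
      + (if w' \<in> N v then y\<^sup>2 * (1 / d v) else 0) - (if v = u then 2 * x * y / d u else 0)" for v
    using w xy unfolding nbr
    by (auto simp: power2_eq_square algebra_simps add_divide_distrib diff_divide_distrib)
  then have "(\<Sum>v\<in>V. (nbr_sum f v)\<^sup>2 / d v) \<le> (\<Sum>v\<in>V. (if w \<in> N v then x\<^sup>2 * (1 / d v) else 0)
      + (if w' \<in> N v then y\<^sup>2 * (1 / d v) else 0) - (if v = u then 2 * x * y / d u else 0))"
    by (intro sum_mono)
  also have "\<dots> = x\<^sup>2 * (\<Sum>v\<in>N w. 1 / d v) + y\<^sup>2 * (\<Sum>v\<in>N w'. 1 / d v) - 2 * x * y / d u"
    using V by (simp add: sum.distrib sum_subtractf sum_N_if sum_distrib_left)
  finally have upper: "(\<Sum>v\<in>V. (nbr_sum f v)\<^sup>2 / d v) \<le> \<dots>" .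
  have "(\<Sum>v\<in>V. d v * (f v)\<^sup>2) =
      (\<Sum>v\<in>V. (if v = w then d w * x\<^sup>2 else 0) + (if v = w' then d w' * y\<^sup>2 else 0))"
    using w(3) by (intro sum.cong) (auto simp: f_def)
  also have "\<dots> = d w * x\<^sup>2 + d w' * y\<^sup>2"
    using V by (simp add: sum.distrib)
  finally show ?thesis
    using gap[of f] upper by (simp add: excess_def algebra_simps)
qed

lemma excess_pos:
  assumes "w \<in> N u" "w' \<in> N u" "w \<noteq> w'"
  shows "excess w > 0"
proof (rule ccontr)
  assume "\<not> excess w > 0"
  \<comment> \<open>With \<open>y = 1\<close> this makes the cross term larger than
    \<open>excess w'\<close>.\<close>
  define x where "x = d u * (\<bar>excess w'\<bar> + 1)"
  have du: "d u > 0"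
    using assms N_in_V d_pos by blast
  have "2 * x * 1 / d u \<le> x\<^sup>2 * excess w + 1\<^sup>2 * excess w'"
    using du by (intro excess_pair_form[OF assms]) (auto simp: x_def)
  moreover have "x\<^sup>2 * excess w \<le> 0"
    using \<open>\<not> excess w > 0\<close> by (simp add: mult_nonneg_nonpos)
  moreover have "2 * x * 1 / d u = 2 * (\<bar>excess w'\<bar> + 1)"
    using du by (simp add: x_def)
  ultimately show False
    by simp
qed

text \<open>This is the determinant condition for the quadratic form of
  \<open>excess_pair_form\<close>, obtained at \<open>x = 1\<close> and
  \<open>y = d u * excess w\<close>.\<close>

lemma excess_mult:
  assumes "w \<in> N u" "w' \<in> N u" "w \<noteq> w'"
  shows "excess w * excess w' \<ge> 1 / (d u)\<^sup>2"
proof -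
  have du: "d u > 0"
    using assms N_in_V d_pos by blast
  have p: "excess w > 0"
    using excess_pos[OF assms] .
  have "2 * 1 * (d u * excess w) / d u \<le> 1\<^sup>2 * excess w + (d u * excess w)\<^sup>2 * excess w'"
    using du p by (intro excess_pair_form[OF assms]) auto
  then have "excess w * 1 \<le> excess w * ((d u)\<^sup>2 * (excess w * excess w'))"
    using du by (simp add: power2_eq_square mult_ac)
  then have "1 \<le> (d u)\<^sup>2 * (excess w * excess w')"
    using p by (subst (asm) mult_le_cancel_left_pos)
  then show ?thesis
    using du by (simp add: divide_le_eq mult.commute)
qed

section \<open>Degrees in the vicinity of a leaf\<close>

lemma nbhd_deg_one: "deg V E v = 1 \<Longrightarrow> u \<in> N v \<Longrightarrow> N v = {u}"
  by (metis card_1_singletonE deg_card singletonD)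

lemma excess_leaf: "deg V E v = 1 \<Longrightarrow> u \<in> N v \<Longrightarrow> excess v = 1 / d u - 1 / 4"
  using nbhd_deg_one[of v u] by (simp add: excess_def)

text \<open>Positivity of \<open>excess v = 1 / d u - 1 / 4\<close> bounds \<open>d u\<close>, and
  \<open>excess_mult\<close> for \<open>v\<close> and \<open>w\<close> gives the second claim. A
  second leaf at \<open>u\<close> would have excess 1/4 or 1/12, while the required bound is 1 or
  4/3.\<close>

lemma leaf_nbr_deg:
  assumes "deg V E v = 1" "v \<in> N u" "deg V E u \<noteq> 1"
  shows "deg V E u \<in> {2, 3}" and "w \<in> N u \<Longrightarrow> w \<noteq> v \<Longrightarrow> excess w \<ge> 4 / (d u * (4 - d u))"
    and "w \<in> N u \<Longrightarrow> w \<noteq> v \<Longrightarrow> deg V E w \<noteq> 1"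
proof -
  have u: "u \<in> V"
    using assms N_in_V by blast
  have "card (N u) > 0" "card (N u) \<noteq> 1"
    using deg_pos[OF u] assms(3) unfolding deg_card by auto
  then have "card (N u - {v}) \<noteq> 0"
    using assms(2) by (subst card_Diff_singleton) auto
  then obtain w0 where w0: "w0 \<in> N u" "w0 \<noteq> v"
    by (metis Diff_iff card_gt_0_iff equals0I insertI1 neq0_conv)
  have pv: "excess v = 1 / d u - 1 / 4"
    using assms N_sym excess_leaf by blast
  have du: "d u > 0"
    using d_pos[OF u] .
  have "1 / d u - 1 / 4 > 0"
    using excess_pos[of v u w0] w0 assms pv by auto
  then have lt: "d u < 4"
    using du by (simp add: field_simps)
  then show deg: "deg V E u \<in> {2, 3}"
    using deg_pos[OF u] assms(3) by auto
  assume w: "w \<in> N u" "w \<noteq> v"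
  have "1 / (d u)\<^sup>2 \<le> (1 / d u - 1 / 4) * excess w"
    using excess_mult[of v u w] w assms pv by auto
  then show ge: "excess w \<ge> 4 / (d u * (4 - d u))"
    using deg by (auto simp: field_simps)
  show "deg V E w \<noteq> 1"
  proof
    assume "deg V E w = 1"
    then have "excess w = 1 / d u - 1 / 4"
      using w N_sym excess_leaf by blast
    then show False
      using ge deg by auto
  qed
qed

lemma inverse_deg_le: "z \<in> V \<Longrightarrow> deg V E z \<ge> k \<Longrightarrow> k > 0 \<Longrightarrow> 1 / d z \<le> 1 / real k"
  by (intro divide_left_mono) (auto simp: d_pos deg_pos)

text \<open>For the pairs (2, 3) and (3, 3) of degrees of \<open>u\<close> and \<open>w\<close> the excess of one of them is too small.\<close>

lemma adjacent_leaf_nbrs: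
  assumes v: "deg V E v = 1" "v \<in> N u" and q: "deg V E q = 1" "q \<in> N w"
    and uw: "w \<in> N u" and deg: "deg V E u \<noteq> 1" "deg V E w \<noteq> 1"
  shows "deg V E w = 2"
proof (rule ccontr)
  assume "deg V E w \<noteq> 2"
  then have w3: "deg V E w = 3"
    using leaf_nbr_deg(1)[OF q deg(2)] by simp
  have wu: "u \<in> N w"
    using uw N_sym by blast
  have ne: "w \<noteq> v" "u \<noteq> q"
    using v q deg by auto
  have u23: "deg V E u = 2 \<or> deg V E u = 3"
    using leaf_nbr_deg(1)[OF v deg(1)] by simp
  show False
  proof (cases "deg V E u = 2")
    case True
    have "card (N u) = 2"
      using True by (simp add: deg_card)
    then have "N u = {v, w}"
      using v uw ne by (auto simp: card_2_iff)
    then have "excess u = 1 / d v + 1 / d w - d u / 4"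
      using ne by (simp add: excess_def)
    \<comment> \<open>Here \<open>excess u\<close> is 5/6, but the leaf \<open>q\<close> at
      \<open>w\<close> demands at least 4/3.\<close>
    then show False
      using leaf_nbr_deg(2)[OF q deg(2) wu ne(2)] v True w3 by simp
  next
    case False
    then have u3: "deg V E u = 3"
      using u23 by simp
    have "card (N w - {q} - {u}) = 1"
      using w3 q wu ne by (simp add: deg_card card_Diff_singleton)
    then obtain t where t: "N w - {q} - {u} = {t}"
      by (meson card_1_singletonE)
    then have tw: "t \<in> N w" "t \<noteq> q" "t \<noteq> u"
      by auto
    have tV: "t \<in> V"
      using tw N_in_V by blast
    \<comment> \<open>Two leaves cannot share the neighbour \<open>w\<close>.\<close>
    have "deg V E t \<ge> 2"
      using leaf_nbr_deg(3)[OF q deg(2) tw(1,2)] deg_pos[OF tV] by simp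
    then have "1 / d t \<le> 1 / 2"
      using inverse_deg_le[OF tV, of 2] by simp
    moreover have "N w = {q, u, t}"
      using t q wu by auto
    then have "excess w = 1 / d q + 1 / d u + 1 / d t - d w / 4"
      using ne tw by (simp add: excess_def)
    \<comment> \<open>Here \<open>excess w\<close> is at most 13/12, but the leaf \<open>v\<close>
      at \<open>u\<close> demands at least 4/3.\<close>
    ultimately show False
      using leaf_nbr_deg(2)[OF v deg(1) uw ne(1)] q w3 u3 by simp
  qed
qed

section \<open>The test function centred at a second neighbour of the leaf\<close>

lemma sum_card_nbrs_Int:
  assumes "S \<subseteq> V"
  shows "(\<Sum>x\<in>V. real (card (N x \<inter> S))) = (\<Sum>y\<in>S. d y)"
proof -
  have "(\<Sum>x\<in>V. real (card (N x \<inter> S))) = (\<Sum>x\<in>V. \<Sum>y\<in>N x. if y \<in> S then 1 else 0)"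
    by (intro sum.cong refl) (simp add: sum.If_cases)
  also have "\<dots> = (\<Sum>y\<in>V. if y \<in> S then d y else 0)"
    by (subst sum_nbr_swap) (auto simp: deg_card intro!: sum.cong)
  also have "\<dots> = (\<Sum>y\<in>S. d y)"
    using assms by (simp add: sum.If_cases Int_absorb1)
  finally show ?thesis .
qed

text \<open>The gap inequality for the test function \<open>f\<close> is distributed over the neighbours \<open>z\<close>
  of \<open>w\<close> with shares \<open>\<tau> z\<close>. Positive shares belong to \<open>Bad\<close> neighbours only; these have excess
  below \<open>1 / d w\<close>, so by \<open>excess_mult\<close> there is at most one of them, and its share is
  outweighed by that of \<open>u\<close>.\<close>

lemma no_leaf_free_second_nbr:
  assumes v: "deg V E v = 1" "v \<in> N u" and u: "deg V E u \<noteq> 1"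
    and w: "w \<in> N u" "w \<noteq> v" and no_leaf: "\<And>z. z \<in> N w \<Longrightarrow> deg V E z \<noteq> 1"
  shows False
proof -
  define A where "A = {z \<in> N w. deg V E z \<le> 3}"
  define L where "L = {y. deg V E y = 1 \<and> (\<exists>z\<in>A. z \<in> N y)}"
  define Y where "Y = {y. deg V E y = 2 \<and> y \<noteq> w \<and> (\<exists>z\<in>A. z \<in> N y)}"
  define l where "l x = real (card (N x \<inter> L))" for x
  define n where "n x = real (card (N x \<inter> Y))" for x
  \<comment> \<open>The negative values next to \<open>z\<close> in \<open>A\<close> offset the
    value 1 of \<open>w\<close> in the neighbour sum at \<open>z\<close>.\<close>
  define f where "f x = (if x = w then 1 else 0) - (if x \<in> L then 1 else 0)
    - (if x \<in> Y then 1 / 2 else 0 :: real)" for x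
  \<comment> \<open>The terms 1/4 and \<open>l z / 4\<close> distribute the parts
    \<open>d w / 4\<close> and \<open>card L / 4\<close> of |f|^2 / 4. For \<open>Y\<close>,
    vertices outside \<open>N w\<close> contribute at most \<open>n x / 4\<close> each; as the
    \<open>n x\<close> sum to \<open>2 * card Y\<close>, a net \<open>3 / 8 * card Y\<close> remains
    after subtracting \<open>card Y / 8\<close>, together with \<open>- n z / 4\<close> on
    \<open>N w\<close>. Charging \<open>card Y\<close> to \<open>A\<close> gives 3/8 - 1/4 = 1/8
    there.\<close>
  define \<tau> where "\<tau> z = (1 - l z - n z / 2)\<^sup>2 / d z - 1 / 4 - l z / 4
    + (if z \<in> A then n z / 8 else - n z / 4)" for z
  define Bad where "Bad = {z \<in> A. N z \<inter> L = {} \<and> N z \<inter> Y = {}}"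
  have wV: "w \<in> V"
    using w N_in_V by blast
  have w1: "deg V E w \<noteq> 1"
    using leaf_nbr_deg(3)[OF v u w] .
  have LY: "L \<subseteq> V" "Y \<subseteq> V" "L \<inter> Y = {}" "w \<notin> L" "w \<notin> Y"
    using N_in_V w1 by (auto simp: L_def Y_def)
  have [simp]: "finite L" "finite Y"
    using LY finite_V finite_subset by blast+
  have uw: "u \<in> N w"
    using w N_sym by blast
  have uA: "u \<in> A"
    using uw leaf_nbr_deg(1)[OF v u] by (auto simp: A_def)
  have vL: "v \<in> N u \<inter> L"
    using v uA N_sym by (auto simp: L_def)
  have nbr: "nbr_sum f x = (if w \<in> N x then 1 else 0) - l x - n x / 2" for x
    unfolding nbr_sum_def f_def l_def n_def by (simp add: sum_subtractf sum.If_cases)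
  have lhs: "(\<Sum>x\<in>V. d x * (f x)\<^sup>2) = d w + card L + card Y / 2"
  proof -
    have "(\<Sum>x\<in>V. d x * (f x)\<^sup>2) = (\<Sum>x\<in>V. (if x = w then d w else 0)
        + (if x \<in> L then 1 else 0) + (if x \<in> Y then 1 / 2 else 0))"
      using LY by (intro sum.cong refl) (auto simp: f_def L_def Y_def power2_eq_square)
    also have "\<dots> = d w + card L + card Y / 2"
      using LY wV by (simp add: sum.distrib sum.If_cases Int_absorb1)
    finally show ?thesis .
  qed
  have l0: "l x = 0" if "x \<notin> A" for x
  proof -
    have "N x \<inter> L = {}"
    proof (rule ccontr)
      assume "N x \<inter> L \<noteq> {}"
      then obtain y z where "x \<in> N y" "deg V E y = 1" "z \<in> A" "z \<in> N y"
        using N_sym by (auto simp: L_def)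
      then show False
        using nbhd_deg_one[of y x] that by auto
    qed
    then show ?thesis
      by (simp add: l_def)
  qed
  have n_le: "n x \<le> d x" for x
    unfolding n_def deg_card by (simp add: card_mono)
  have sum_n: "(\<Sum>x\<in>V. n x) = 2 * card Y"
    unfolding n_def by (subst sum_card_nbrs_Int[OF LY(2)]) (simp add: Y_def)
  have sum_l: "(\<Sum>x\<in>N w. l x) = card L"
  proof -
    have "(\<Sum>x\<in>N w. l x) = (\<Sum>x\<in>V. l x)"
      using N_subset l0 by (intro sum.mono_neutral_left) (auto simp: A_def)
    also have "\<dots> = card L"
      unfolding l_def by (subst sum_card_nbrs_Int[OF LY(1)]) (simp add: L_def)
    finally show ?thesis .
  qed
  have cardY: "real (card Y) \<le> (\<Sum>z\<in>N w. if z \<in> A then n z else 0)"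
  proof -
    have fA: "finite A"
      by (simp add: A_def)
    have "Y \<subseteq> (\<Union>z\<in>A. N z \<inter> Y)"
      using N_sym by (auto simp: Y_def)
    then have "card Y \<le> card (\<Union>z\<in>A. N z \<inter> Y)"
      using fA by (intro card_mono) auto
    also have "\<dots> \<le> (\<Sum>z\<in>A. card (N z \<inter> Y))"
      by (rule card_UN_le[OF fA])
    finally have "real (card Y) \<le> (\<Sum>z\<in>A. n z)"
      unfolding n_def by (metis of_nat_le_iff of_nat_sum)
    also have "(\<Sum>z\<in>A. n z) = (\<Sum>z\<in>N w. if z \<in> A then n z else 0)"
      by (simp add: A_def sum.inter_filter)
    finally show ?thesis .
  qed
  have "(nbr_sum f x)\<^sup>2 / d x \<le>
      n x / 4 + (if w \<in> N x then (1 - l x - n x / 2)\<^sup>2 / d x - n x / 4 else 0)" if x: "x \<in> V" for x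
  proof (cases "w \<in> N x")
    case False
    then have "x \<notin> A"
      using N_sym by (auto simp: A_def)
    then have "(nbr_sum f x)\<^sup>2 / d x = n x * (n x / d x) / 4"
      using False by (simp add: nbr l0 power2_eq_square)
    also have "\<dots> \<le> n x * 1 / 4"
      using n_le[of x] d_pos[OF x] by (intro divide_right_mono mult_left_mono) (auto simp: n_def)
    finally show ?thesis
      using False by simp
  qed (simp add: nbr)
  then have "(\<Sum>x\<in>V. (nbr_sum f x)\<^sup>2 / d x) \<le> (\<Sum>x\<in>V. n x / 4
      + (if w \<in> N x then (1 - l x - n x / 2)\<^sup>2 / d x - n x / 4 else 0))"
    by (intro sum_mono)
  also have "\<dots> = card Y / 2 + (\<Sum>x\<in>N w. (1 - l x - n x / 2)\<^sup>2 / d x - n x / 4)"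
    by (simp add: sum.distrib sum_N_if sum_n flip: sum_divide_distrib)
  finally have "d w / 4 + card L / 4 \<le> 3 / 8 * card Y
      + (\<Sum>x\<in>N w. (1 - l x - n x / 2)\<^sup>2 / d x - n x / 4)"
    using gap[of f] lhs by simp
  also have "\<dots> \<le> 3 / 8 * (\<Sum>z\<in>N w. if z \<in> A then n z else 0)
      + (\<Sum>x\<in>N w. (1 - l x - n x / 2)\<^sup>2 / d x - n x / 4)"
    using cardY by simp
  finally have "0 \<le> (\<Sum>z\<in>N w. 3 / 8 * (if z \<in> A then n z else 0)
      + ((1 - l z - n z / 2)\<^sup>2 / d z - n z / 4) - 1 / 4 - l z / 4)"
    by (simp add: sum.distrib sum_subtractf sum_l deg_card flip: sum_distrib_left sum_divide_distrib)
  also have "\<dots> = (\<Sum>z\<in>N w. \<tau> z)"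
    by (intro sum.cong refl) (simp add: \<tau>_def)
  finally have nonneg: "0 \<le> (\<Sum>z\<in>N w. \<tau> z)" .

  \<comment> \<open>One neighbour of \<open>z\<close> is lost: \<open>w\<close> lies in neither
    \<open>L\<close> nor \<open>Y\<close>.\<close>
  have card_le: "card (N z \<inter> L) + card (N z \<inter> Y) \<le> deg V E z - 1" if "z \<in> N w" for z
  proof -
    have "card (N z \<inter> L) + card (N z \<inter> Y) = card (N z \<inter> L \<union> N z \<inter> Y)"
      using LY by (intro card_Un_disjoint[symmetric]) auto
    also have "\<dots> \<le> card (N z - {w})"
      using LY by (intro card_mono) auto
    also have "\<dots> = deg V E z - 1"
      using that N_sym by (simp add: deg_card card_Diff_singleton)
    finally show ?thesis .
  qed
  have degA: "deg V E z \<in> {2, 3}" if "z \<in> A" for z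
    using that no_leaf[of z] deg_pos[of z] N_in_V by (fastforce simp: A_def)
  \<comment> \<open>A finite check. The value -7/24 occurs at degree 3 with one neighbour in
    \<open>L\<close> and one in \<open>Y\<close>; the value 1/4 occurs at degree 2 with none in
    either set.\<close>
  have small: "\<tau> z \<le> (if 0 < card (N z \<inter> L) then - 7 / 24 else
      if card (N z \<inter> L) = 0 \<and> card (N z \<inter> Y) = 0 then 1 / 4 else 0)" if z: "z \<in> A" for z
  proof -
    have zw: "z \<in> N w"
      using z by (simp add: A_def)
    define a b where "a = card (N z \<inter> L)" and "b = card (N z \<inter> Y)"
    have ab: "a + b \<le> deg V E z - 1"
      using card_le[OF zw] by (simp add: a_def b_def)
    have ln: "l z = real a" "n z = real b"
      by (simp_all add: l_def n_def a_def b_def)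
    have "a \<le> 2" "b \<le> 2"
      using ab degA[OF z] by auto
    then have "a \<in> {0, 1, 2}" "b \<in> {0, 1, 2}"
      by auto
    then show ?thesis
      using ab degA[OF z] z unfolding \<tau>_def ln a_def[symmetric] b_def[symmetric]
      by (auto simp: power2_eq_square)
  qed
  \<comment> \<open>From degree 4 on, the value 1 at \<open>w\<close> costs at most 1/4 at
    \<open>z\<close> without any correction; hence the threshold 3 in \<open>A\<close>.\<close>
  have large: "\<tau> z \<le> 0" if z: "z \<in> N w" "z \<notin> A" for z
  proof -
    have d4: "d z \<ge> 4"
      using z by (simp add: A_def)
    have "n z * n z \<le> n z * d z"
      using n_le by (intro mult_left_mono) (auto simp: n_def)
    moreover have "n z \<ge> 0"
      by (simp add: n_def)
    ultimately have "(1 - n z / 2)\<^sup>2 \<le> (1 / 4 + n z / 4) * d z"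
      using d4 by (simp add: power2_eq_square algebra_simps)
    then have "(1 - n z / 2)\<^sup>2 / d z \<le> 1 / 4 + n z / 4"
      using d4 by (simp add: pos_divide_le_eq)
    moreover have "\<tau> z = (1 - n z / 2)\<^sup>2 / d z - 1 / 4 - n z / 4"
      using z by (simp add: \<tau>_def l0)
    ultimately show ?thesis
      by linarith
  qed
  have bound: "\<tau> z \<le> (if z = u then - 7 / 24 else 0) + (if z \<in> Bad then 1 / 4 else 0)"
    if "z \<in> N w" for z
  proof (cases "z \<in> A")
    case True
    have "card (N u \<inter> L) > 0"
      using vL by (auto simp: card_gt_0_iff)
    then show ?thesis
      using small[OF True] True by (auto simp: Bad_def split: if_splits)
  next
    case False
    then show ?thesis
      using large[OF that] uA by (auto simp: Bad_def)
  qed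
  \<comment> \<open>A neighbour of \<open>z\<close> other than \<open>w\<close> with degree 1 or 2
    would lie in \<open>L\<close> or \<open>Y\<close>, so all of them have degree at least
    3.\<close>
  have bad_excess: "excess z < 1 / d w" if "z \<in> Bad" for z
  proof -
    have z: "z \<in> A" "z \<in> N w"
      using that by (auto simp: Bad_def A_def)
    have wz: "w \<in> N z"
      using z N_sym by blast
    have "1 / d y \<le> 1 / 3" if y: "y \<in> N z - {w}" for y
    proof -
      have yV: "y \<in> V" and zy: "z \<in> N y"
        using y N_in_V N_sym by blast+
      have "deg V E y \<noteq> 1" "deg V E y \<noteq> 2"
        using \<open>z \<in> Bad\<close> z zy y by (auto simp: Bad_def L_def Y_def)
      then show ?thesis
        using inverse_deg_le[OF yV, of 3] deg_pos[OF yV] by simp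
    qed
    then have "(\<Sum>y\<in>N z - {w}. 1 / d y) \<le> real (card (N z - {w})) * (1 / 3)"
      by (intro sum_bounded_above)
    also have "\<dots> = (d z - 1) / 3"
      using wz degA[OF z(1)] by (auto simp: deg_card card_Diff_singleton)
    finally have "excess z \<le> 1 / d w + (d z - 1) / 3 - d z / 4"
      unfolding excess_def using wz by (simp add: sum.remove)
    then show ?thesis
      using degA[OF z(1)] by auto
  qed
  have finBad: "finite Bad" "Bad \<subseteq> N w"
    by (auto simp: Bad_def A_def)
  have "z = z'" if "z \<in> Bad" "z' \<in> Bad" for z z'
  proof (rule ccontr)
    assume "z \<noteq> z'"
    then have "1 / (d w)\<^sup>2 \<le> excess z * excess z'" "excess z > 0" "excess z' > 0"
      using excess_mult[of z w z'] excess_pos[of z w z'] excess_pos[of z' w z] that finBad by auto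
    moreover have "excess z * excess z' < 1 / d w * (1 / d w)"
      using bad_excess that \<open>excess z > 0\<close> \<open>excess z' > 0\<close> by (intro mult_strict_mono') auto
    ultimately show False
      by (simp add: power2_eq_square)
  qed
  then have "card Bad \<le> 1"
    using finBad by (simp add: card_le_Suc0_iff_eq)
  have "(\<Sum>z\<in>N w. \<tau> z) \<le> (\<Sum>z\<in>N w. (if z = u then - 7 / 24 else 0) + (if z \<in> Bad then 1 / 4 else 0))"
    by (intro sum_mono bound)
  \<comment> \<open>A single bad neighbour adds 1/4, which is less than the 7/24 gained at
    \<open>u\<close>.\<close>
  also have "\<dots> = - 7 / 24 + card Bad / 4"
    using uw finBad by (simp add: sum.distrib sum.If_cases Int_absorb1)
  also have "\<dots> < 0"
    using \<open>card Bad \<le> 1\<close> by simp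
  finally show False
    using nonneg by simp
qed

end

section \<open>Connectivity and the identification of the path on four vertices\<close>

lemma connected_graph_closed:
  assumes "connected_graph V E" "x \<in> V" "x \<in> S" "\<And>y z. y \<in> S \<Longrightarrow> E y z \<Longrightarrow> z \<in> S"
  shows "V \<subseteq> S"
proof
  fix y
  assume "y \<in> V"
  then have "E\<^sup>*\<^sup>* x y"
    using assms by (simp add: connected_graph_def)
  then show "y \<in> S"
    by (induction rule: rtranclp_induct) (use assms in auto)
qed

theorem mainTheorem13:
  fixes V :: "'a set" and E :: "'a \<Rightarrow> 'a \<Rightarrow> bool"
  assumes "simple_graph V E"
    and "connected_graph V E"
    and "card V \<ge> 3"
    and "min_degree V E = 1"
    and "\<not> is_P4 V E"
  shows "spectral_gap_eps V E < 1 / 2"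
proof (rule ccontr)
  assume "\<not> spectral_gap_eps V E < 1 / 2"
  then have eps: "spectral_gap_eps V E \<ge> 1 / 2"
    by simp
  have ne: "V \<noteq> {}" and fin: "finite V"
    using assms by (auto simp: simple_graph_def)
  interpret positive_degree_graph V E
  proof
    show "deg V E v > 0" if "v \<in> V" for v
      using Min_le[of "deg V E ` V" "deg V E v"] fin that assms(4)
      by (fastforce simp: min_degree_def)
  qed (fact assms(1))
  interpret half_gap_graph V E
  proof
    fix f :: "'a \<Rightarrow> real"
    have "(1 / 2)\<^sup>2 \<le> (spectral_gap_eps V E)\<^sup>2"
      using eps by (intro power_mono) auto
    then have "(1 / 2)\<^sup>2 * (\<Sum>x\<in>V. d x * (f x)\<^sup>2) \<le> (spectral_gap_eps V E)\<^sup>2 * (\<Sum>x\<in>V. d x * (f x)\<^sup>2)"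
      by (intro mult_right_mono sum_nonneg) auto
    then show "(\<Sum>x\<in>V. d x * (f x)\<^sup>2) \<le> 4 * (\<Sum>x\<in>V. (nbr_sum f x)\<^sup>2 / d x)"
      using spectral_gap_bound[OF ne, of f] by (simp add: power2_eq_square)
  qed
  have "min_degree V E \<in> deg V E ` V"
    unfolding min_degree_def using fin ne by (intro Min_in) auto
  then obtain v where v: "v \<in> V" "deg V E v = 1"
    using assms(4) by (metis imageE)
  then obtain u where Nv: "N v = {u}"
    by (metis card_1_singletonE deg_card)
  then have vu: "v \<in> N u"
    using N_sym by blast
  \<comment> \<open>Otherwise \<open>u\<close> and \<open>v\<close> would form a component with only
    two vertices.\<close>
  have u1: "deg V E u \<noteq> 1"
  proof
    assume "deg V E u = 1"
    then have "N u = {v}"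
      using nbhd_deg_one vu by blast
    then have "z \<in> {v, u}" if "y \<in> {v, u}" "E y z" for y z
      using that Nv N_iff[of z y] by auto
    then have "V \<subseteq> {v, u}"
      using connected_graph_closed[OF assms(2) v(1), of "{v, u}"] by blast
    then have "card V \<le> card {v, u}"
      by (intro card_mono) auto
    then show False
      using assms(3) card_insert_le_m1[of 2 "{u}" v] by simp
  qed
  have "N u \<noteq> {v}"
    using u1 by (auto simp: deg_card)
  then obtain w where w: "w \<in> N u" "w \<noteq> v"
    using vu by blast
  have w1: "deg V E w \<noteq> 1"
    using leaf_nbr_deg(3)[OF v(2) vu u1 w] .
  have uw: "u \<in> N w"
    using w N_sym by blast
  obtain q where q: "q \<in> N w" "deg V E q = 1"
    using no_leaf_free_second_nbr[OF v(2) vu u1 w] by blast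
  have "card (N w) = 2"
    using adjacent_leaf_nbrs[OF v(2) vu q(2,1) w(1) u1 w1] by (simp add: deg_card)
  moreover have "q \<noteq> u"
    using q u1 by blast
  ultimately have Nw: "N w = {u, q}"
    using q uw by (auto simp: card_2_iff)
  \<comment> \<open>The situation is symmetric under exchanging the pairs \<open>v\<close>,
    \<open>u\<close> and \<open>q\<close>, \<open>w\<close>.\<close>
  have "card (N u) = 2"
    using adjacent_leaf_nbrs[OF q(2,1) v(2) vu uw w1 u1] by (simp add: deg_card)
  then have Nu: "N u = {v, w}"
    using vu w by (auto simp: card_2_iff)
  have Nq: "N q = {w}"
    using q N_sym nbhd_deg_one by blast
  have "u \<noteq> w"
    using w by auto
  moreover have "v \<noteq> q"
    using Nv Nq \<open>u \<noteq> w\<close> by auto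
  moreover have "v \<noteq> u" "w \<noteq> q"
    using vu q by auto
  ultimately have dist: "distinct [v, u, w, q]"
    using w \<open>q \<noteq> u\<close> by simp
  have E_iff: "E v y \<longleftrightarrow> y = u" "E u y \<longleftrightarrow> y = v \<or> y = w"
    "E w y \<longleftrightarrow> y = u \<or> y = q" "E q y \<longleftrightarrow> y = w" for y
    unfolding N_iff[of y, symmetric] by (simp_all add: Nv Nu Nw Nq)
  \<comment> \<open>All four neighbourhoods are now known, so the path is closed under adjacency and
    connectivity makes it the whole graph.\<close>
  have "z \<in> {v, u, w, q}" if "y \<in> {v, u, w, q}" "E y z" for y z
    using that E_iff by blast
  then have "V \<subseteq> {v, u, w, q}"
    using connected_graph_closed[OF assms(2) v(1), of "{v, u, w, q}"] by blast
  then have V: "V = {v, u, w, q}"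
    using v w q N_in_V uw by blast
  have "E x y \<longleftrightarrow> {x, y} \<in> {{v, u}, {u, w}, {w, q}}" for x y
  proof (cases "x \<in> V")
    case True
    then consider "x = v" | "x = u" | "x = w" | "x = q"
      using V by blast
    then show ?thesis
      by cases (use dist E_iff in \<open>auto simp: doubleton_eq_iff\<close>)
  next
    case False
    then have "\<not> E x y"
      using N_in_V(2)[of y x] N_iff by blast
    then show ?thesis
      using False V by (simp add: doubleton_eq_iff)
  qed
  then have "is_P4 V E"
    unfolding is_P4_def using dist V by blast
  then show False
    using assms(5) by blast
qed

end
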